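(* Let $G$ be a complete graph on $n=2^k+1$ vertices (for an integer $k$), with the weight of each edge drawn independently from the uniform distribution on $[0,1]$. Then the expected number of 2-optimal tours on $G$ is $O\left(1.2098^n\sqrt{n!}\right)$.
   Context: A tour is a Hamiltonian cycle; its weight is the sum of its edge weights. A 2-change on a tour $T$ removes two non-adjacent edges of $T$ and adds the unique pair of edges not in $T$ that reconnects the two resulting paths into a new tour. A tour is 2-optimal if no 2-change yields a tour of strictly smaller weight. *)

theory Defs
  imports "HOL-Probability.Probability" "HOL-Library.Landau_Symbols"
begin

text \<open>Undirected edges are two-element sets of vertices.\<close>

definition complete_edges :: "'a set \<Rightarrow> 'a set set" where
  "complete_edges V = {e. e \<subseteq> V \<and> card e = 2}"

text \<open>
  A tour is identified with its set of edges, so cyclic rotations and the reversal of a vertex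
  order give the same tour.  The condition \<open>3 \<le> length xs\<close> excludes the degenerate cyclic
  orders, which are not cycles of a simple graph.
\<close>

definition cycle_edges :: "'a list \<Rightarrow> 'a set set" where
  "cycle_edges xs = {{xs ! i, xs ! (Suc i mod length xs)} | i. i < length xs}"

definition is_tour :: "'a set \<Rightarrow> 'a set set \<Rightarrow> bool" where
  "is_tour V T \<longleftrightarrow> (\<exists>xs. distinct xs \<and> set xs = V \<and> 3 \<le> length xs \<and> T = cycle_edges xs)"

definition tour_weight :: "('a set \<Rightarrow> real) \<Rightarrow> 'a set set \<Rightarrow> real" where
  "tour_weight w T = (\<Sum>e\<in>T. w e)"

text \<open>
  Two distinct edges are non-adjacent iff they are disjoint.  If \<open>e\<^sub>1 = {a, b}\<close> and
  \<open>e\<^sub>2 = {c, d}\<close> are met in the order \<open>a, b, \<dots>, c, d\<close> along \<open>T\<close>, the only admissible pair of new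
  edges is \<open>{a, c}\<close>, \<open>{b, d}\<close>: by degrees the new edges match up \<open>a, b, c, d\<close>, the matching
  \<open>{a, b}\<close>, \<open>{c, d}\<close> lies in \<open>T\<close>, and \<open>{a, d}\<close>, \<open>{b, c}\<close> closes the two paths into two separate
  components.
\<close>

definition two_change :: "'a set \<Rightarrow> 'a set set \<Rightarrow> 'a set set \<Rightarrow> bool" where
  "two_change V T T' \<longleftrightarrow> is_tour V T \<and> is_tour V T' \<and>
     (\<exists>e\<^sub>1\<in>T. \<exists>e\<^sub>2\<in>T. e\<^sub>1 \<inter> e\<^sub>2 = {} \<and>
       (\<exists>f\<^sub>1 \<in> complete_edges V - T. \<exists>f\<^sub>2 \<in> complete_edges V - T. f\<^sub>1 \<noteq> f\<^sub>2 \<and>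
         T' = (T - {e\<^sub>1, e\<^sub>2}) \<union> {f\<^sub>1, f\<^sub>2}))"

definition two_optimal :: "'a set \<Rightarrow> ('a set \<Rightarrow> real) \<Rightarrow> 'a set set \<Rightarrow> bool" where
  "two_optimal V w T \<longleftrightarrow> is_tour V T \<and>
     \<not> (\<exists>T'. two_change V T T' \<and> tour_weight w T' < tour_weight w T)"

definition random_weights :: "'a set \<Rightarrow> ('a set \<Rightarrow> real) measure" where
  "random_weights V = Pi\<^sub>M (complete_edges V) (\<lambda>_. uniform_measure lborel {0..1})"

definition expected_two_optimal :: "'a set \<Rightarrow> real" where
  "expected_two_optimal V = (\<integral>w. real (card {T. two_optimal V w T}) \<partial>random_weights V)"

lemma prob_space_random_weights: "prob_space (random_weights V)"
  unfolding random_weights_def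
  by (intro prob_space_PiM prob_space_uniform_measure) auto

lemma cycle_edges_subset:
  assumes "distinct xs" "2 \<le> length xs"
  shows "cycle_edges xs \<subseteq> complete_edges (set xs)"
proof
  fix e assume "e \<in> cycle_edges xs"
  then obtain i where i: "i < length xs" "e = {xs ! i, xs ! (Suc i mod length xs)}"
    by (auto simp: cycle_edges_def)
  have j: "Suc i mod length xs < length xs" using assms(2) by (intro mod_less_divisor) auto
  have "i \<noteq> Suc i mod length xs"
    using i assms(2) by (cases "Suc i = length xs") auto
  then have "xs ! i \<noteq> xs ! (Suc i mod length xs)"
    using assms(1) i(1) j by (simp add: nth_eq_iff_index_eq)
  then show "e \<in> complete_edges (set xs)"
    using i j by (auto simp: complete_edges_def)
qed

lemma is_tour_subset: "is_tour V T \<Longrightarrow> T \<subseteq> complete_edges V"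
  using cycle_edges_subset by (fastforce simp: is_tour_def)

lemma finite_tours:
  assumes "finite V" shows "finite {T. is_tour V T}"
proof (rule finite_subset)
  show "{T. is_tour V T} \<subseteq> Pow (Pow V)"
    using is_tour_subset by (fastforce simp: complete_edges_def)
qed (use assms in auto)

text \<open>The number of 2-optimal tours is an integrable random variable, so its expectation is
  not the default value of the Bochner integral.\<close>

lemma measurable_tour_weight:
  assumes "is_tour V T"
  shows "(\<lambda>w. tour_weight w T) \<in> borel_measurable (random_weights V)"
  unfolding tour_weight_def random_weights_def
proof (rule borel_measurable_sum)
  fix e assume "e \<in> T"
  then have "e \<in> complete_edges V" using is_tour_subset[OF assms] by auto
  then have "(\<lambda>w. w e) \<in> Pi\<^sub>M (complete_edges V) (\<lambda>_. uniform_measure lborel {0..1::real})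
      \<rightarrow>\<^sub>M uniform_measure lborel {0..1}"
    by (rule measurable_component_singleton)
  also have "\<dots> = Pi\<^sub>M (complete_edges V) (\<lambda>_. uniform_measure lborel {0..1::real}) \<rightarrow>\<^sub>M borel"
    by (rule measurable_cong_sets) auto
  finally show "(\<lambda>w. w e) \<in> borel_measurable
      (Pi\<^sub>M (complete_edges V) (\<lambda>_. uniform_measure lborel {0..1::real}))" .
qed

lemma integrable_count_two_optimal:
  assumes "finite V"
  shows "integrable (random_weights V) (\<lambda>w. real (card {T. two_optimal V w T}))"
proof -
  interpret prob_space "random_weights V" by (rule prob_space_random_weights)
  let ?A = "{T. is_tour V T}"
  have fin: "finite ?A" by (rule finite_tours[OF assms])
  have eq: "real (card {T. two_optimal V w T}) = (\<Sum>T\<in>?A. if two_optimal V w T then 1 else 0)"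
    for w
  proof -
    have "{T. two_optimal V w T} = {T \<in> ?A. two_optimal V w T}"
      by (auto simp: two_optimal_def)
    then show ?thesis using fin by (simp add: sum.If_cases Int_def)
  qed
  have "(\<lambda>w. if two_optimal V w T then 1 else 0 :: real) \<in> borel_measurable (random_weights V)"
    if T: "T \<in> ?A" for T
  proof -
    let ?N = "{T'. two_change V T T'}"
    have N: "finite ?N" "\<And>T'. T' \<in> ?N \<Longrightarrow> is_tour V T'"
      by (auto simp: two_change_def intro: finite_subset[OF _ fin])
    have "two_optimal V w T \<longleftrightarrow> (\<forall>T'\<in>?N. tour_weight w T \<le> tour_weight w T')" for w
      using T by (auto simp: two_optimal_def not_less)
    moreover have "Measurable.pred (random_weights V)
        (\<lambda>w. \<forall>T'\<in>?N. tour_weight w T \<le> tour_weight w T')"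
    proof (rule pred_intros_finite(3)[OF N(1)])
      fix T' assume "T' \<in> ?N"
      then show "Measurable.pred (random_weights V) (\<lambda>w. tour_weight w T \<le> tour_weight w T')"
        unfolding pred_def using N(2) T by (intro borel_measurable_le measurable_tour_weight) auto
    qed
    ultimately show ?thesis by (intro measurable_If) auto
  qed
  then have "(\<lambda>w. real (card {T. two_optimal V w T})) \<in> borel_measurable (random_weights V)"
    unfolding eq by (rule borel_measurable_sum)
  moreover have "real (card {T. two_optimal V w T}) \<le> real (card ?A)" for w
    by (intro of_nat_mono card_mono fin) (auto simp: two_optimal_def)
  ultimately show ?thesis
    by (intro integrable_const_bound[where B = "real (card ?A)"]) auto
qed

end

theory Submission
  imports Defs "HOL-Number_Theory.Cong" "HOL-Combinatorics.Multiset_Permutations"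
begin

text \<open>
  Let \<open>n = 2 m + 1\<close>, fix a tour \<open>v\<^sub>0, \<dots>, v\<^bsub>n-1\<^esub>\<close> and let \<open>x\<^sub>i\<close> be the weight of \<open>{v\<^sub>i, v\<^bsub>i+1\<^esub>}\<close>. The 2-change
  on the tour edges \<open>i\<close> and \<open>i + d\<close> inserts the chords \<open>{v\<^sub>i, v\<^bsub>i+d\<^esub>}\<close> and \<open>{v\<^bsub>i+1\<^esub>, v\<^bsub>i+d+1\<^esub>}\<close>, so for each
  \<open>2 \<le> d \<le> m\<close> every second \<open>i\<close> gives \<open>m\<close> 2-changes that are independent given \<open>x\<close>. Two uniform
  variables have sum at least \<open>s\<close> with probability at most \<open>exp (- s\<^sup>2 / 2)\<close>. Dropping the cross terms
  of \<open>(x\<^sub>i + x\<^bsub>i+d\<^esub>)\<^sup>2\<close> and averaging over the choice of the independent families, the tour is 2-optimal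
  with conditional probability at most \<open>exp (- \<beta> \<Sum> x\<^sub>i\<^sup>2)\<close>, where \<open>\<beta> = m (m - 1) / n \<approx> n / 4\<close>.
  Integrating over \<open>x\<close> gives at most \<open>(sqrt (\<pi> / \<beta>) / 2) ^ n\<close> per tour. There are at most \<open>n!\<close> tours, and
  \<open>n! (\<pi> / n) ^ (n / 2)\<close> is about \<open>sqrt (n!) (\<pi> / e) ^ (n / 2)\<close>, where \<open>sqrt (\<pi> / e) < 1.0752\<close>. This leaves
  room for crude estimates.
\<close>

subsection \<open>Chords of a tour of odd length\<close>

text \<open>The enumeration \<open>v\<close> is periodic on all naturals, so \<open>i + d\<close> is
  never reduced by hand. As \<open>n\<close> is odd, no two vertices are antipodal, and each
  distance \<open>d\<close> from 1 to \<open>m\<close> yields exactly \<open>n\<close>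
  edges.\<close>

locale cyclic_order =
  fixes V :: "'a set" and v :: "nat \<Rightarrow> 'a" and m n :: nat
  assumes m: "2 \<le> m" and n: "n = 2 * m + 1"
    and v_eq_iff: "v i = v j \<longleftrightarrow> [i = j] (mod n)" and range_v: "v ` {..<n} = V"
begin

text \<open>Every edge of the complete graph is \<open>edge d i\<close> for exactly one \<open>1 \<le> d \<le> m\<close> and one residue \<open>i\<close>
  modulo \<open>n\<close>; the tour consists of the edges with \<open>d = 1\<close>.\<close>

definition edge :: "nat \<Rightarrow> nat \<Rightarrow> 'a set" where
  "edge d i = {v i, v (i + d)}"

definition tour :: "'a set set" where
  "tour = edge 1 ` {..<n}"

lemma finite_tour: "finite tour"
  by (simp add: tour_def)

lemma n_pos: "0 < n" using n by simp

lemma v_in [simp]: "v i \<in> V"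
proof -
  have "v i = v (i mod n)" by (simp add: v_eq_iff cong_def)
  then show ?thesis using range_v n_pos by auto
qed

lemma edge_cong: "[i = j] (mod n) \<Longrightarrow> edge d i = edge d j"
  by (auto simp: edge_def v_eq_iff intro!: arg_cong2[where f = insert] cong_add)

text \<open>The endpoints match either in order, which gives the claim, or crosswise. The crossed
  case would force \<open>n\<close> to divide \<open>d + d'\<close>, but this number lies between 2
  and \<open>2 * m < n\<close>.\<close>

lemma edge_eq_iff:
  assumes d: "1 \<le> d" "d \<le> m" and d': "1 \<le> d'" "d' \<le> m"
  shows "edge d i = edge d' i' \<longleftrightarrow> d = d' \<and> [i = i'] (mod n)"
proof
  assume "edge d i = edge d' i'"
  then have "v i = v i' \<and> v (i + d) = v (i' + d') \<or> v i = v (i' + d') \<and> v (i + d) = v i'"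
    by (auto simp: edge_def doubleton_eq_iff)
  then show "d = d' \<and> [i = i'] (mod n)"
  proof
    assume *: "v i = v i' \<and> v (i + d) = v (i' + d')"
    then have i: "[i = i'] (mod n)" and "[i + d = i' + d'] (mod n)" by (auto simp: v_eq_iff)
    moreover have "[i + d = i' + d] (mod n)" using i by (intro cong_add) auto
    ultimately have "[i' + d = i' + d'] (mod n)" by (metis cong_sym cong_trans)
    then have "[d = d'] (mod n)" by (simp add: cong_add_lcancel_nat)
    then show ?thesis using d d' n i by (auto intro: cong_less_modulus_unique_nat)
  next
    assume *: "v i = v (i' + d') \<and> v (i + d) = v i'"
    then have i: "[i = i' + d'] (mod n)" "[i + d = i'] (mod n)" by (auto simp: v_eq_iff)
    have "[i + d + d' = i' + d'] (mod n)" using i(2) by (intro cong_add) auto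
    then have "[i + (d + d') = i] (mod n)" using i(1) by (metis add.assoc cong_sym cong_trans)
    then have "n dvd d + d'" by (simp add: cong_add_lcancel_0_nat cong_0_iff)
    then show ?thesis using d d' n by (auto dest: dvd_imp_le)
  qed
qed (use edge_cong in blast)

lemma edge_complete:
  assumes "1 \<le> d" "d \<le> m" shows "edge d i \<in> complete_edges V"
proof -
  have "v i \<noteq> v (i + d)"
  proof
    assume "v i = v (i + d)"
    then have "[i + d = i] (mod n)" by (simp add: v_eq_iff cong_sym_eq)
    then have "n dvd d" by (simp add: cong_add_lcancel_0_nat cong_0_iff)
    then show False using assms n by (auto dest: dvd_imp_le)
  qed
  then show ?thesis by (auto simp: complete_edges_def edge_def)
qed

lemma edge_notin_tour: "2 \<le> d \<Longrightarrow> d \<le> m \<Longrightarrow> edge d i \<notin> tour"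
  using m by (auto simp: tour_def edge_eq_iff)

lemma edge_in_tour: "edge 1 i \<in> tour"
proof -
  have "edge 1 i = edge 1 (i mod n)" by (rule edge_cong) (simp add: cong_def)
  then show ?thesis using n_pos by (auto simp: tour_def)
qed

lemma inj_tour_edge: "inj_on (edge 1) {..<n}"
  using m by (auto simp: inj_on_def edge_eq_iff intro: cong_less_modulus_unique_nat)

section \<open>Tours from vertex enumerations, and the 2-changes on them\<close>

lemma cycle_edges_map:
  "cycle_edges (map u [0..<n]) = (\<lambda>i. {u i, u (Suc i mod n)}) ` {..<n}"
proof -
  have "cycle_edges xs = (\<lambda>i. {xs ! i, xs ! (Suc i mod length xs)}) ` {..<length xs}" for xs :: "'b list"
    by (auto simp: cycle_edges_def)
  then have "cycle_edges (map u [0..<n]) =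
      (\<lambda>i. {map u [0..<n] ! i, map u [0..<n] ! (Suc i mod n)}) ` {..<n}"
    by (simp only: length_map length_upt diff_zero)
  also have "\<dots> = (\<lambda>i. {u i, u (Suc i mod n)}) ` {..<n}"
    by (rule image_cong) (use n_pos in simp_all)
  finally show ?thesis .
qed

lemma is_tour_map:
  assumes "inj_on u {..<n}" "u ` {..<n} = V"
  shows "is_tour V ((\<lambda>i. {u i, u (Suc i mod n)}) ` {..<n})"
  unfolding is_tour_def
proof (intro exI conjI)
  show "distinct (map u [0..<n])"
    using assms(1) by (simp only: distinct_map set_upt atLeast0LessThan distinct_upt simp_thms)
  show "set (map u [0..<n]) = V"
    using assms(2) by (simp only: set_map set_upt atLeast0LessThan)
  show "3 \<le> length (map u [0..<n])" using m n by simp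
qed (rule cycle_edges_map[symmetric])

lemma v_mod: "v (i mod n) = v i"
  by (simp add: v_eq_iff cong_def)

lemma inj_v: "inj_on v {..<n}"
  by (auto simp: inj_on_def v_eq_iff intro: cong_less_modulus_unique_nat)

lemma is_tour_tour: "is_tour V tour"
  using is_tour_map[OF inj_v range_v] by (simp add: tour_def edge_def[abs_def] v_mod)

text \<open>Reversing a segment alters only the two edges at its ends. With base point 0 the
  reversed segment does not wrap around modulo \<open>n\<close>; other base points follow by
  rotation.\<close>

lemma two_change_base:
  assumes d: "2 \<le> d" "d \<le> m"
  shows "two_change V tour ((tour - {edge 1 0, edge 1 d}) \<union> {edge d 0, edge d 1})"
proof -
  \<comment> \<open>The new tour traverses the segment \<open>v 1, \<dots>, v d\<close> backwards.\<close>
  define \<sigma> where "\<sigma> i = (if 1 \<le> i \<and> i \<le> d then Suc d - i else i)" for i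
  define u where "u = v \<circ> \<sigma>"
  define F where "F i = {u i, u (Suc i mod n)}" for i
  have \<sigma>\<sigma>: "\<sigma> (\<sigma> i) = i" for i by (auto simp: \<sigma>_def)
  have \<sigma>_less: "i < n \<Longrightarrow> \<sigma> i < n" for i using d n by (auto simp: \<sigma>_def)
  have bij: "bij_betw \<sigma> {..<n} {..<n}"
    by (rule bij_betw_byWitness[of _ \<sigma>]) (auto simp: \<sigma>\<sigma> \<sigma>_less)
  have tour': "is_tour V (F ` {..<n})"
    unfolding F_def
  proof (rule is_tour_map)
    show "inj_on u {..<n}" unfolding u_def
      using bij inj_v by (metis bij_betw_def comp_inj_on)
    show "u ` {..<n} = V" unfolding u_def
      using bij range_v by (metis bij_betw_def image_comp)
  qed
  have F0: "F 0 = edge d 0" using d n m by (auto simp: F_def u_def \<sigma>_def edge_def)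
  have Fd: "F d = edge d 1" using d n by (auto simp: F_def u_def \<sigma>_def edge_def)
  \<comment> \<open>Inside the reversed segment the old edges reappear in the opposite order, so the
    set of these edges is unchanged.\<close>
  have F1: "F i = edge 1 (d - i)" if "i \<in> {1..<d}" for i
    using that d n by (auto simp: F_def u_def \<sigma>_def edge_def Suc_diff_le)
  have F2: "F i = edge 1 i" if "i \<in> {d<..<n}" for i
  proof -
    have "\<sigma> (Suc i mod n) = Suc i mod n"
      using that d by (cases "Suc i = n") (auto simp: \<sigma>_def)
    then show ?thesis using that by (simp add: F_def u_def edge_def v_mod) (simp add: \<sigma>_def)
  qed
  have img: "F ` {1..<d} = edge 1 ` {1..<d}"
  proof -
    have "F ` {1..<d} = edge 1 ` ((\<lambda>i. d - i) ` {1..<d})"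
      unfolding image_image by (rule image_cong) (use F1 in auto)
    also have "(\<lambda>i. d - i) ` {1..<d} = {1..<d}"
    proof -
      have "i \<in> (\<lambda>i. d - i) ` {1..<d}" if "i \<in> {1..<d}" for i
        using that by (intro image_eqI[of _ _ "d - i"]) auto
      then show ?thesis by auto
    qed
    finally show ?thesis .
  qed
  have split: "{..<n} = {0, d} \<union> ({1..<d} \<union> {d<..<n})" using d n by auto
  have "tour - {edge 1 0, edge 1 d} = edge 1 ` ({..<n} - {0, d})"
    unfolding tour_def using inj_tour_edge d n n_pos
    by (subst inj_on_image_set_diff[OF inj_tour_edge]) auto
  also have "{..<n} - {0, d} = {1..<d} \<union> {d<..<n}" using d n by auto
  also have "edge 1 ` \<dots> = F ` ({1..<d} \<union> {d<..<n})"
    unfolding image_Un img using F2 by (auto simp: image_iff)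
  finally have T': "F ` {..<n} = (tour - {edge 1 0, edge 1 d}) \<union> {edge d 0, edge d 1}"
    unfolding split image_Un using F0 Fd by auto
  have disj: "edge 1 0 \<inter> edge 1 d = {}"
    using d n by (auto simp: edge_def v_eq_iff dest: cong_less_modulus_unique_nat)
  have neq: "edge d 0 \<noteq> edge d 1"
    using d n by (auto simp: edge_eq_iff dest: cong_less_modulus_unique_nat)
  have d1: "1 \<le> d" using d by simp
  have old: "edge 1 0 \<in> tour" "edge 1 d \<in> tour" by (rule edge_in_tour)+
  have new: "edge d i \<in> complete_edges V - tour" for i
    using edge_complete[OF d1 d(2)] edge_notin_tour[OF d] by simp
  show ?thesis unfolding two_change_def T'[symmetric]
    by (intro conjI is_tour_tour tour' bexI[OF _ old(1)] bexI[OF _ old(2)] disj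
        bexI[OF _ new[of 0]] bexI[OF _ new[of 1]] neq T')
qed

text \<open>Rotation symmetry: it reduces statements about an arbitrary base point to base point 0.
  Surjectivity follows from injectivity by counting.\<close>

lemma shift: "cyclic_order V (\<lambda>i. v (b + i)) m n"
proof
  have "(\<lambda>i. v (b + i)) ` {..<n} \<subseteq> V" by auto
  moreover have "inj_on (\<lambda>i. v (b + i)) {..<n}"
    by (auto simp: inj_on_def v_eq_iff cong_add_lcancel_nat intro: cong_less_modulus_unique_nat)
  moreover have "card V = n" using card_image[OF inj_v] range_v by simp
  moreover have "finite V" using range_v by (metis finite_imageI finite_lessThan)
  ultimately show "(\<lambda>i. v (b + i)) ` {..<n} = V"
    by (intro card_subset_eq) (auto simp: card_image)
qed (use m n in \<open>auto simp: v_eq_iff cong_add_lcancel_nat\<close>)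

lemma finite_V: "finite V"
  using range_v by (metis finite_imageI finite_lessThan)

lemma card_tour: "card tour = n"
  unfolding tour_def using card_image[OF inj_tour_edge] by simp

lemma two_change_chords:
  assumes d: "2 \<le> d" "d \<le> m"
  shows "two_change V tour ((tour - {edge 1 i, edge 1 (i + d)}) \<union> {edge d i, edge d (i + 1)})"
proof -
  interpret s: cyclic_order V "\<lambda>j. v (i + j)" m n by (rule shift)
  have e: "s.edge c j = edge c (i + j)" for c j by (simp add: s.edge_def edge_def add.assoc)
  have "s.tour \<subseteq> tour" unfolding s.tour_def e using edge_in_tour by auto
  then have "s.tour = tour"
    by (intro card_subset_eq finite_tour) (auto simp: card_tour s.card_tour)
  then show ?thesis using s.two_change_base[OF d] by (simp add: e)
qed

text \<open>The edges common to both tours cancel when their weights are compared. The two removed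
  edges are distinct, and so are the two added ones, hence each sum has two separate terms.\<close>

lemma two_optimal_le:
  assumes opt: "two_optimal V w tour" and d: "2 \<le> d" "d \<le> m"
  shows "w (edge 1 i) + w (edge 1 (i + d)) \<le> w (edge d i) + w (edge d (i + 1))"
proof -
  let ?O = "{edge 1 i, edge 1 (i + d)}" and ?N = "{edge d i, edge d (i + 1)}"
  have O: "?O \<subseteq> tour" using edge_in_tour by auto
  have "\<not> [i = i + d] (mod n)"
  proof
    assume "[i = i + d] (mod n)"
    then have "n dvd d" by (metis cong_0_iff cong_add_lcancel_0_nat cong_sym)
    then show False using d n by (auto dest: dvd_imp_le)
  qed
  then have ne1: "edge 1 i \<noteq> edge 1 (i + d)" using m by (subst edge_eq_iff) auto
  have "\<not> [i = i + 1] (mod n)"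
  proof
    assume "[i = i + 1] (mod n)"
    then have "n dvd 1" by (metis cong_0_iff cong_add_lcancel_0_nat cong_sym)
    then show False using d n by auto
  qed
  then have ne2: "edge d i \<noteq> edge d (i + 1)" using d by (subst edge_eq_iff) auto
  have "tour_weight w tour \<le> tour_weight w ((tour - ?O) \<union> ?N)"
    using opt two_change_chords[OF d] by (auto simp: two_optimal_def not_less)
  also have "\<dots> = sum w (tour - ?O) + sum w ?N"
    unfolding tour_weight_def using finite_tour edge_notin_tour[OF d]
    by (intro sum.union_disjoint) auto
  finally have "sum w ?O \<le> sum w ?N"
    unfolding tour_weight_def using sum.subset_diff[OF O finite_tour, of w] by simp
  then show ?thesis using ne1 ne2 by simp
qed

end

lemma is_tour_cyclic_order:
  assumes T: "is_tour V T" and "card V = 2 * m + 1" "2 \<le> m"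
  obtains v where "cyclic_order V v m (2 * m + 1)" "T = cyclic_order.tour v (2 * m + 1)"
proof -
  obtain xs where xs: "distinct xs" "set xs = V" "T = cycle_edges xs"
    using T by (auto simp: is_tour_def)
  define n where "n = 2 * m + 1"
  have len: "length xs = n" using xs assms(2) by (metis distinct_card n_def)
  define v where "v i = xs ! (i mod n)" for i
  have n0: "0 < n" by (simp add: n_def)
  interpret cyclic_order V v m n
  proof
    show "v i = v j \<longleftrightarrow> [i = j] (mod n)" for i j
      using xs(1) len n0 by (auto simp: v_def cong_def nth_eq_iff_index_eq)
    show "v ` {..<n} = V"
      using xs(2) len by (auto simp: v_def set_conv_nth)
  qed (use assms n_def in auto)
  have "T = tour" using xs(3) len n0
    by (auto simp: cycle_edges_def tour_def edge_def v_def)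
  then show ?thesis using that cyclic_order_axioms unfolding n_def by blast
qed

subsection \<open>Sums of uniform variables\<close>

abbreviation unif :: "real measure" where
  "unif \<equiv> uniform_measure lborel {0..1}"

lemma prob_space_unif: "prob_space unif"
  by (intro prob_space_uniform_measure) auto

interpretation unif: prob_space unif by (rule prob_space_unif)

lemma product_prob_space_unif: "product_prob_space (\<lambda>_. unif)"
  by (intro product_prob_spaceI prob_space_unif)

lemma product_sigma_finite_unif: "product_sigma_finite (\<lambda>_. unif)"
  by (intro product_sigma_finite.intro unif.sigma_finite_measure_axioms)

lemma nn_integral_unif:
  "f \<in> borel_measurable borel \<Longrightarrow> (\<integral>\<^sup>+x. f x \<partial>unif) = (\<integral>\<^sup>+x. f x * indicator {0..1} x \<partial>lborel)"
  by (subst nn_integral_uniform_measure) (auto simp: divide_ennreal_def)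

lemma emeasure_unif_atLeast: "emeasure unif {t..} \<le> ennreal (min 1 (max 0 (1 - t)))"
proof (cases "t \<le> 0")
  case True
  then show ?thesis using unif.emeasure_le_1[of "{t..}"] by (simp add: min_def max_def)
next
  case False
  then have "{0..1} \<inter> {t..} = {t..1}" by auto
  then show ?thesis using False by (cases "t \<le> 1") (auto simp: min_def max_def divide_ennreal_def)
qed

lemma sets_unif_add_ge: "{z. s \<le> fst z + snd z} \<in> sets (unif \<Otimes>\<^sub>M unif)"
proof -
  have "sets (unif \<Otimes>\<^sub>M unif) = sets (borel \<Otimes>\<^sub>M borel)" by (intro sets_pair_measure_cong) auto
  moreover have "{z. s \<le> fst z + snd z} \<in> sets (borel \<Otimes>\<^sub>M borel :: (real \<times> real) measure)"
    unfolding borel_prod by (intro borel_closed closed_Collect_le continuous_intros)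
  ultimately show ?thesis by simp
qed

text \<open>The tail of the triangular distribution is \<open>1 - s^2 / 2\<close> on
  \<open>[0,1]\<close>, \<open>(2 - s)^2 / 2\<close> on \<open>[1,2]\<close> and 0 beyond. The first
  is handled by \<open>1 + x \<le> exp x\<close> directly, the second after squaring such an
  estimate.\<close>

lemma emeasure_unif_add_ge:
  assumes s: "0 \<le> s"
  shows "emeasure (unif \<Otimes>\<^sub>M unif) {z. s \<le> fst z + snd z} \<le> ennreal (exp (- (s\<^sup>2 / 2)))"
proof -
  \<comment> \<open>\<open>g u\<close> bounds the probability that the second variable is at least
    \<open>s - u\<close>, given that the first equals \<open>u\<close>.\<close>
  define g where "g u = min 1 (max 0 (1 - (s - u)))" for u
  have "emeasure (unif \<Otimes>\<^sub>M unif) {z. s \<le> fst z + snd z} =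
      (\<integral>\<^sup>+u. emeasure unif (Pair u -` {z. s \<le> fst z + snd z}) \<partial>unif)"
    using sets_unif_add_ge by (rule unif.emeasure_pair_measure_alt)
  also have "\<dots> = (\<integral>\<^sup>+u. emeasure unif {s - u..} \<partial>unif)"
    by (intro nn_integral_cong arg_cong2[where f = emeasure]) auto
  also have "\<dots> \<le> (\<integral>\<^sup>+u. ennreal (g u) \<partial>unif)"
    unfolding g_def by (intro nn_integral_mono emeasure_unif_atLeast)
  also have "\<dots> = (\<integral>\<^sup>+u. ennreal (g u) * indicator {0..1} u \<partial>lborel)"
    unfolding g_def by (intro nn_integral_unif) measurable
  also have "\<dots> \<le> ennreal (exp (- (s\<^sup>2 / 2)))"
  proof (cases "s \<le> 1")
    case True
    have "ennreal (g u) * indicator {0..1} u \<le>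
        ennreal (1 - s + u) * indicator {0..s} u + ennreal 1 * indicator {s..1} u" for u
    proof (cases "u \<in> {0..s}")
      case True
      then have "ennreal (g u) * indicator {0..1} u \<le> ennreal (1 - s + u) * indicator {0..s} u"
        using \<open>s \<le> 1\<close> by (auto simp: g_def intro!: ennreal_leI simp del: ennreal_plus)
      then show ?thesis by (simp add: add_increasing2)
    qed (use \<open>s \<le> 1\<close> in \<open>auto simp: g_def split: split_indicator\<close>)
    then have "(\<integral>\<^sup>+u. ennreal (g u) * indicator {0..1} u \<partial>lborel) \<le>
        (\<integral>\<^sup>+u. ennreal (1 - s + u) * indicator {0..s} u + ennreal 1 * indicator {s..1} u \<partial>lborel)"
      by (intro nn_integral_mono)
    also have "\<dots> = (\<integral>\<^sup>+u. ennreal (1 - s + u) * indicator {0..s} u \<partial>lborel) +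
        (\<integral>\<^sup>+u. ennreal 1 * indicator {s..1} u \<partial>lborel)"
      by (rule nn_integral_add) auto
    also have "(\<integral>\<^sup>+u. ennreal (1 - s + u) * indicator {0..s} u \<partial>lborel) =
        ennreal (((1 - s) * s + s\<^sup>2 / 2) - ((1 - s) * 0 + 0\<^sup>2 / 2))"
      using s True
      by (intro nn_integral_FTC_Icc) (auto intro!: derivative_eq_intros)
    also have "(\<integral>\<^sup>+u. ennreal 1 * indicator {s..1} u \<partial>lborel) = ennreal (1 - s)"
      using True by simp
    also have "ennreal (((1 - s) * s + s\<^sup>2 / 2) - ((1 - s) * 0 + 0\<^sup>2 / 2)) + ennreal (1 - s) =
        ennreal (1 - s\<^sup>2 / 2)"
      using s True mult_left_mono[of s 2 s] by (subst ennreal_plus[symmetric]) (auto simp: power2_eq_square algebra_simps)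
    also have "\<dots> \<le> ennreal (exp (- (s\<^sup>2 / 2)))"
      using exp_ge_add_one_self[of "- (s\<^sup>2 / 2)"] by (intro ennreal_leI) simp
    finally show ?thesis .
  next
    case False
    show ?thesis
    proof (cases "s \<le> 2")
      case True
      have "(\<integral>\<^sup>+u. ennreal (g u) * indicator {0..1} u \<partial>lborel) \<le>
          (\<integral>\<^sup>+u. ennreal (1 - s + u) * indicator {s - 1..1} u \<partial>lborel)"
        using False by (intro nn_integral_mono)
          (auto simp: g_def ennreal_eq_0_iff split: split_indicator)
      also have "\<dots> = ennreal ((1 - s + 1)\<^sup>2 / 2 - (1 - s + (s - 1))\<^sup>2 / 2)"
        using True False
        by (intro nn_integral_FTC_Icc) (auto intro!: derivative_eq_intros)
      also have "\<dots> = ennreal ((2 - s)\<^sup>2 / 2)" by simp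
      also have "\<dots> \<le> ennreal (exp (- (s\<^sup>2 / 2)))"
      proof (rule ennreal_leI)
        have "2 - s \<le> exp (1 - s)" using exp_ge_add_one_self[of "1 - s"] by simp
        then have "(2 - s)\<^sup>2 \<le> (exp (1 - s))\<^sup>2" using True by (intro power_mono) auto
        \<comment> \<open>Completing the square:
          \<open>2 - 2 * s = - s^2 / 2 + (2 - s)^2 / 2\<close>. For \<open>s\<close> between 1 and 2
          the second factor is at most \<open>exp (1 / 2)\<close>, which the spare factor 2
          absorbs.\<close>
        also have "\<dots> = exp (- (s\<^sup>2 / 2)) * exp ((2 - s)\<^sup>2 / 2)"
          by (simp add: exp_double[symmetric] exp_add[symmetric] power2_eq_square field_simps)
        also have "\<dots> \<le> exp (- (s\<^sup>2 / 2)) * 2"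
        proof (intro mult_left_mono)
          have "(2 - s)\<^sup>2 \<le> 1\<^sup>2" using True False by (intro power_mono) auto
          then have "exp ((2 - s)\<^sup>2 / 2) \<le> exp (1 / 2 :: real)" by simp
          also have "\<dots> \<le> 2" using exp_half_le2 by simp
          finally show "exp ((2 - s)\<^sup>2 / 2) \<le> 2" .
        qed simp
        finally show "(2 - s)\<^sup>2 / 2 \<le> exp (- (s\<^sup>2 / 2))" by simp
      qed
      finally show ?thesis .
    next
      case False
      then have "ennreal (g u) * indicator {0..1} u = 0" for u
        by (auto simp: g_def split: split_indicator)
      then show ?thesis by (simp only: nn_integral_const mult_zero_left zero_le)
    qed
  qed
  finally show ?thesis .
qed

section \<open>Pairs of coordinates in a product of uniform measures\<close>

lemma measurable_component_unif:
  assumes "i \<in> J" shows "(\<lambda>\<omega>. \<omega> i) \<in> borel_measurable (Pi\<^sub>M J (\<lambda>_. unif))"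
proof -
  have "(\<lambda>\<omega>. \<omega> i) \<in> Pi\<^sub>M J (\<lambda>_. unif) \<rightarrow>\<^sub>M unif"
    using assms by (rule measurable_component_singleton)
  also have "\<dots> = borel_measurable (Pi\<^sub>M J (\<lambda>_. unif))" by (rule measurable_cong_sets) auto
  finally show ?thesis .
qed

text \<open>The event depends on the coordinates \<open>a\<close> and \<open>b\<close> only, and
  their marginal is the product of two uniform measures, so the tail bound for two variables
  applies.\<close>

lemma measure_PiM_unif_add_ge:
  assumes J: "finite J" "a \<in> J" "b \<in> J" "a \<noteq> b" and s: "0 \<le> s"
  shows "measure (Pi\<^sub>M J (\<lambda>_. unif)) {\<omega> \<in> space (Pi\<^sub>M J (\<lambda>_. unif)). s \<le> \<omega> a + \<omega> b}
    \<le> exp (- (s\<^sup>2 / 2))"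
proof -
  let ?J = "Pi\<^sub>M J (\<lambda>_. unif)" and ?P = "Pi\<^sub>M {a, b} (\<lambda>_. unif)"
  interpret J: prob_space ?J by (intro prob_space_PiM prob_space_unif)
  have m: "case_prod (\<lambda>u v. indicator {s..} (u + v) :: ennreal) \<in> borel_measurable (unif \<Otimes>\<^sub>M unif)"
  proof -
    have "case_prod (\<lambda>u v. indicator {s..} (u + v) :: ennreal) \<in> borel_measurable (borel \<Otimes>\<^sub>M borel)"
      by measurable
    then show ?thesis
      by (subst measurable_cong_sets[OF sets_pair_measure_cong refl]) auto
  qed
  have "{\<omega> \<in> space ?J. s \<le> \<omega> a + \<omega> b} \<in> sets ?J"
    using J by (intro borel_measurable_le borel_measurable_add measurable_component_unif) auto
  then have "emeasure ?J {\<omega> \<in> space ?J. s \<le> \<omega> a + \<omega> b} =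
      (\<integral>\<^sup>+\<omega>. indicator {\<omega> \<in> space ?J. s \<le> \<omega> a + \<omega> b} \<omega> \<partial>?J)"
    by (rule nn_integral_indicator[symmetric])
  also have "\<dots> = (\<integral>\<^sup>+\<omega>. indicator {s..} (restrict \<omega> {a, b} a + restrict \<omega> {a, b} b) \<partial>?J)"
    by (intro nn_integral_cong) (auto simp: indicator_def)
  also have "\<dots> = (\<integral>\<^sup>+\<omega>. indicator {s..} (\<omega> a + \<omega> b) \<partial>distr ?J ?P (\<lambda>f. restrict f {a, b}))"
  proof (rule nn_integral_distr[symmetric])
    have "(\<lambda>\<omega>. \<omega> a + \<omega> b) \<in> borel_measurable ?P"
      by (intro borel_measurable_add measurable_component_unif) auto
    then have "(\<lambda>\<omega>. indicator {s..} (\<omega> a + \<omega> b) :: ennreal) \<in> borel_measurable ?P"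
      by (rule measurable_compose) auto
    then show "(\<lambda>\<omega>. indicator {s..} (\<omega> a + \<omega> b) :: ennreal) \<in>
        borel_measurable (distr ?J ?P (\<lambda>f. restrict f {a, b}))" by simp
    show "(\<lambda>f. restrict f {a, b}) \<in> ?J \<rightarrow>\<^sub>M ?P"
      using J by (intro measurable_restrict_subset) auto
  qed
  also have "distr ?J ?P (\<lambda>f. restrict f {a, b}) = ?P"
    using J by (intro product_prob_space.distr_restrict[OF product_prob_space_unif, symmetric]) auto
  also have "(\<integral>\<^sup>+\<omega>. indicator {s..} (\<omega> a + \<omega> b) \<partial>?P) =
      (\<integral>\<^sup>+z. indicator {s..} (fst z + snd z) \<partial>(unif \<Otimes>\<^sub>M unif))"
    by (rule product_sigma_finite.product_nn_integral_pair[OF product_sigma_finite_unif m J(4)])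
  also have "\<dots> = (\<integral>\<^sup>+z. indicator {z. s \<le> fst z + snd z} z \<partial>(unif \<Otimes>\<^sub>M unif))"
    by (intro nn_integral_cong) (auto split: split_indicator)
  also have "\<dots> = emeasure (unif \<Otimes>\<^sub>M unif) {z. s \<le> fst z + snd z}"
    by (rule nn_integral_indicator[OF sets_unif_add_ge])
  also have "\<dots> \<le> ennreal (exp (- (s\<^sup>2 / 2)))" by (rule emeasure_unif_add_ge[OF s])
  finally show ?thesis by (simp add: J.emeasure_eq_measure)
qed

text \<open>Independence is equality of the joint law with the product of the marginals. Here
  restriction to \<open>J\<close> is the identity on the space, so the joint law is the product
  measure itself.\<close>

lemma indep_vars_PiM_unif: 
  assumes "finite J" "J \<noteq> {}"
  shows "prob_space.indep_vars (Pi\<^sub>M J (\<lambda>_. unif)) (\<lambda>_. unif) (\<lambda>i \<omega>. \<omega> i) J"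
proof -
  interpret J: prob_space "Pi\<^sub>M J (\<lambda>_. unif)" by (intro prob_space_PiM prob_space_unif)
  have "distr (Pi\<^sub>M J (\<lambda>_. unif)) (Pi\<^sub>M J (\<lambda>_. unif)) (\<lambda>x. \<lambda>i\<in>J. x i) =
      distr (Pi\<^sub>M J (\<lambda>_. unif)) (Pi\<^sub>M J (\<lambda>_. unif)) (\<lambda>x. x)"
    by (intro distr_cong) (auto simp: space_PiM restrict_PiE_iff PiE_iff intro!: extensional_restrict)
  also have "\<dots> = Pi\<^sub>M J (\<lambda>i. distr (Pi\<^sub>M J (\<lambda>_. unif)) unif (\<lambda>\<omega>. \<omega> i))"
    by (subst distr_id) (auto intro!: PiM_cong distr_PiM_component[symmetric] prob_space_unif)
  finally show ?thesis using assms
    by (subst J.indep_vars_iff_distr_eq_PiM') (auto intro: measurable_component_singleton)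
qed

text \<open>Sums over disjoint blocks of coordinates are independent, so the probabilities multiply
  and the exponents add.\<close>

lemma measure_PiM_unif_disjoint_pairs:
  assumes J: "finite J" and L: "finite L"
    and ab: "\<And>p. p \<in> L \<Longrightarrow> a p \<in> J \<and> b p \<in> J \<and> a p \<noteq> b p"
    and disj: "disjoint_family_on (\<lambda>p. {a p, b p}) L"
    and s: "\<And>p. p \<in> L \<Longrightarrow> 0 \<le> s p"
  shows "measure (Pi\<^sub>M J (\<lambda>_. unif))
      {\<omega> \<in> space (Pi\<^sub>M J (\<lambda>_. unif)). \<forall>p\<in>L. s p \<le> \<omega> (a p) + \<omega> (b p)}
    \<le> exp (- (\<Sum>p\<in>L. (s p)\<^sup>2 / 2))"
proof (cases "L = {}")
  case True
  interpret J: prob_space "Pi\<^sub>M J (\<lambda>_. unif)" by (intro prob_space_PiM prob_space_unif)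
  show ?thesis using True by simp
next
  case False
  let ?J = "Pi\<^sub>M J (\<lambda>_. unif)"
  interpret J: prob_space ?J by (intro prob_space_PiM prob_space_unif)
  have "J \<noteq> {}" using False ab by auto
  then have "J.indep_vars (\<lambda>_. unif) (\<lambda>i \<omega>. \<omega> i) J" by (rule indep_vars_PiM_unif[OF J])
  then have "J.indep_vars (\<lambda>p. Pi\<^sub>M {a p, b p} (\<lambda>_. unif)) (\<lambda>p \<omega>. restrict (\<lambda>i. \<omega> i) {a p, b p}) L"
    using ab disj by (intro J.indep_vars_restrict) auto
  then have "J.indep_vars (\<lambda>_. borel)
      (\<lambda>p \<omega>. restrict (\<lambda>i. \<omega> i) {a p, b p} (a p) + restrict (\<lambda>i. \<omega> i) {a p, b p} (b p)) L"
    by (rule J.indep_vars_compose2[where Y = "\<lambda>p f. f (a p) + f (b p)"])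
      (intro borel_measurable_add measurable_component_unif, auto)
  then have ind: "J.indep_vars (\<lambda>_. borel) (\<lambda>p \<omega>. \<omega> (a p) + \<omega> (b p)) L" by simp
  have "{\<omega> \<in> space ?J. \<forall>p\<in>L. s p \<le> \<omega> (a p) + \<omega> (b p)} =
      (\<Inter>p\<in>L. (\<lambda>\<omega>. \<omega> (a p) + \<omega> (b p)) -` {s p..} \<inter> space ?J)"
    using False by auto
  then have "J.prob {\<omega> \<in> space ?J. \<forall>p\<in>L. s p \<le> \<omega> (a p) + \<omega> (b p)} =
      (\<Prod>p\<in>L. J.prob ((\<lambda>\<omega>. \<omega> (a p) + \<omega> (b p)) -` {s p..} \<inter> space ?J))"
    using J.indep_varsD_finite[OF ind False L, of "\<lambda>p. {s p..}"] by simp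
  also have "\<dots> \<le> (\<Prod>p\<in>L. exp (- ((s p)\<^sup>2 / 2)))"
  proof (rule prod_mono, safe)
    fix p assume p: "p \<in> L"
    have "(\<lambda>\<omega>. \<omega> (a p) + \<omega> (b p)) -` {s p..} \<inter> space ?J = {\<omega> \<in> space ?J. s p \<le> \<omega> (a p) + \<omega> (b p)}"
      by auto
    then show "J.prob ((\<lambda>\<omega>. \<omega> (a p) + \<omega> (b p)) -` {s p..} \<inter> space ?J) \<le> exp (- ((s p)\<^sup>2 / 2))"
      using measure_PiM_unif_add_ge[OF J, of "a p" "b p" "s p"] ab[OF p] s[OF p] by simp
  qed simp
  also have "\<dots> = exp (- (\<Sum>p\<in>L. (s p)\<^sup>2 / 2))"
    using L by (simp add: exp_sum[symmetric] sum_negf)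
  finally show ?thesis .
qed

text \<open>Enlarging \<open>[0,1]\<close> to the half line and rescaling by
  \<open>sqrt \<beta>\<close> leaves half of the Gaussian integral.\<close>

lemma nn_integral_unif_gaussian:
  assumes "0 < \<beta>"
  shows "(\<integral>\<^sup>+x. ennreal (exp (- (\<beta> * x\<^sup>2))) \<partial>unif) \<le> ennreal (sqrt (pi / \<beta>) / 2)"
proof -
  let ?f = "\<lambda>x::real. ennreal (indicator {0..} x *\<^sub>R exp (- x\<^sup>2))"
  have gauss: "(\<integral>\<^sup>+x. ?f x \<partial>lborel) = ennreal (sqrt pi / 2)"
    using has_bochner_integral_iff[THEN iffD1, OF gaussian_moment_0]
    by (subst nn_integral_eq_integral) auto
  have \<beta>: "sqrt \<beta> > 0" using assms by simp
  have "(\<integral>\<^sup>+x. ?f x \<partial>lborel) = ennreal (sqrt \<beta>) * (\<integral>\<^sup>+x. ?f (sqrt \<beta> * x) \<partial>lborel)"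
    using nn_integral_real_affine[of ?f "sqrt \<beta>" 0] \<beta> by simp
  then have scaled: "ennreal (sqrt \<beta>) * (\<integral>\<^sup>+x. ?f (sqrt \<beta> * x) \<partial>lborel) = ennreal (sqrt pi / 2)"
    using gauss by simp
  have "(\<integral>\<^sup>+x. ?f (sqrt \<beta> * x) \<partial>lborel) =
      ennreal (1 / sqrt \<beta>) * (ennreal (sqrt \<beta>) * (\<integral>\<^sup>+x. ?f (sqrt \<beta> * x) \<partial>lborel))"
    using \<beta> by (simp add: mult.assoc[symmetric] ennreal_mult[symmetric])
  also have "\<dots> = ennreal (sqrt (pi / \<beta>) / 2)"
    unfolding scaled using \<beta> by (simp add: ennreal_mult[symmetric] real_sqrt_divide)
  finally have *: "(\<integral>\<^sup>+x. ?f (sqrt \<beta> * x) \<partial>lborel) = ennreal (sqrt (pi / \<beta>) / 2)" .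
  have "(\<integral>\<^sup>+x. ennreal (exp (- (\<beta> * x\<^sup>2))) \<partial>unif) =
      (\<integral>\<^sup>+x. ennreal (exp (- (\<beta> * x\<^sup>2))) * indicator {0..1} x \<partial>lborel)"
    by (rule nn_integral_unif) measurable
  also have "\<dots> \<le> (\<integral>\<^sup>+x. ?f (sqrt \<beta> * x) \<partial>lborel)"
    using assms by (intro nn_integral_mono)
      (auto simp: power_mult_distrib zero_le_mult_iff split: split_indicator)
  finally show ?thesis unfolding * .
qed

subsection \<open>The probability that a tour is 2-optimal\<close>

context cyclic_order
begin

text \<open>Moving the start by one drops the term \<open>f c\<close> and gains
  \<open>f (c + n)\<close>, which is equal.\<close>

lemma sum_shift_periodic:
  fixes f :: "nat \<Rightarrow> real"
  assumes "\<And>i. f (i + n) = f i"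
  shows "(\<Sum>i<n. f (c + i)) = (\<Sum>i<n. f i)"
proof (induction c)
  case (Suc c)
  have "f c + (\<Sum>i<n. f (Suc c + i)) = (\<Sum>i<Suc n. f (c + i))"
    by (subst sum.lessThan_Suc_shift) simp
  also have "\<dots> = (\<Sum>i<n. f (c + i)) + f c" using assms[of c] by simp
  finally show ?case using Suc by simp
qed simp

lemma cong_add_less_imp_eq:
  assumes "[r + x = r + y] (mod n)" "x < n" "y < n"
  shows "x = y"
  using assms by (auto simp: cong_add_lcancel_nat intro: cong_less_modulus_unique_nat)

text \<open>For fixed \<open>d\<close> the pairs occupy the consecutive offsets \<open>2 * j\<close>
  and \<open>2 * j + 1\<close>, all below \<open>2 * m < n\<close>, hence distinct residues. Chords
  of different distances differ anyway.\<close>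

lemma disjoint_chord_pairs:
  "disjoint_family_on (\<lambda>(d, j). {edge d (r + 2 * j), edge d (r + 2 * j + 1)}) ({2..m} \<times> {..<m})"
proof -
  have inj: "d = d' \<and> j = j'"
    if dj: "d \<in> {2..m}" "d' \<in> {2..m}" "j < m" "j' < m" "k < 2" "k' < 2"
      and eq: "edge d (r + (2 * j + k)) = edge d' (r + (2 * j' + k'))" for d d' j j' k k'
  proof -
    have "1 \<le> d" "d \<le> m" "1 \<le> d'" "d' \<le> m" using dj by auto
    from edge_eq_iff[OF this, THEN iffD1, OF eq]
    have d: "d = d'" and c: "[r + (2 * j + k) = r + (2 * j' + k')] (mod n)" by auto
    have "2 * j + k = 2 * j' + k'"
      by (rule cong_add_less_imp_eq[OF c]) (use dj n in auto)
    then show ?thesis using d dj(5,6) by presburger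
  qed
  show ?thesis
    unfolding disjoint_family_on_def
  proof (intro ballI impI)
    fix p q assume pq: "p \<in> {2..m} \<times> {..<m}" "q \<in> {2..m} \<times> {..<m}" "p \<noteq> q"
    obtain d j d' j' where [simp]: "p = (d, j)" "q = (d', j')" by (cases p, cases q)
    have ne: "edge d (r + (2 * j + k)) \<noteq> edge d' (r + (2 * j' + k'))" if "k < 2" "k' < 2" for k k'
      using inj[of d d' j j' k k'] that pq by auto
    show "(case p of (d, j) \<Rightarrow> {edge d (r + 2 * j), edge d (r + 2 * j + 1)}) \<inter>
        (case q of (d, j) \<Rightarrow> {edge d (r + 2 * j), edge d (r + 2 * j + 1)}) = {}"
      using ne[of 0 0] ne[of 0 1] ne[of 1 0] ne[of 1 1] by simp
  qed
qed

text \<open>This is the \<open>\<beta>\<close> of the introduction: \<open>m - 1\<close> distances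
  with \<open>m\<close> independent 2-changes each, averaged over \<open>n\<close> offsets.\<close>

definition decay :: real where
  "decay = real (m * (m - 1)) / real n"

lemma decay_pos: "0 < decay"
  unfolding decay_def using m n by simp

text \<open>For each \<open>r\<close>, the 2-changes \<open>(d, r + 2 j)\<close> with \<open>j < m\<close> use disjoint chords, hence are independent
  given the weights \<open>x\<close> of the tour edges. Averaging the resulting exponents over all \<open>r\<close> treats the
  tour edges symmetrically.\<close>

lemma measure_chords_le:
  fixes x :: "'a set \<Rightarrow> real"
  assumes x: "\<And>e. e \<in> tour \<Longrightarrow> 0 \<le> x e"
  defines "M \<equiv> Pi\<^sub>M (complete_edges V - tour) (\<lambda>_. unif)"
  shows "measure M {y \<in> space M. \<forall>d\<in>{2..m}. \<forall>i.
      x (edge 1 i) + x (edge 1 (i + d)) \<le> y (edge d i) + y (edge d (i + 1))}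
    \<le> exp (- (decay * (\<Sum>e\<in>tour. (x e)\<^sup>2)))" (is "measure M ?A \<le> _")
proof (rule ccontr)
  assume neg: "\<not> measure M ?A \<le> exp (- (decay * (\<Sum>e\<in>tour. (x e)\<^sup>2)))"
  define X where "X = (\<Sum>e\<in>tour. (x e)\<^sup>2)"
  define L where "L = {2..m} \<times> {..<m}"
  define f where "f i = (x (edge 1 i))\<^sup>2" for i
  define s where "s r p = x (edge 1 (r + 2 * snd p)) + x (edge 1 (r + 2 * snd p + fst p))" for r p
  define q where "q r = (\<Sum>p\<in>L. (s r p)\<^sup>2 / 2)" for r
  interpret M: prob_space M unfolding M_def by (intro prob_space_PiM prob_space_unif)
  have fin: "finite (complete_edges V)"
    using finite_V by (simp add: complete_edges_def)
  have chord: "edge d i \<in> complete_edges V - tour" if "d \<in> {2..m}" for d i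
    using that edge_complete[of d] edge_notin_tour[of d] by auto
  have f_periodic: "f (i + n) = f i" for i
    unfolding f_def by (subst edge_cong[of "i + n" i]) (auto simp: cong_def)
  have X: "(\<Sum>i<n. f i) = X"
    unfolding X_def tour_def f_def by (subst sum.reindex[OF inj_tour_edge]) simp
  have bound: "measure M ?A \<le> exp (- q r)" for r
  proof -
    define a where "a p = edge (fst p) (r + 2 * snd p)" for p
    define b where "b p = edge (fst p) (r + 2 * snd p + 1)" for p
    have "measure M ?A \<le> measure M {y \<in> space M. \<forall>p\<in>L. s r p \<le> y (a p) + y (b p)}"
    proof (rule M.finite_measure_mono)
      show "?A \<subseteq> {y \<in> space M. \<forall>p\<in>L. s r p \<le> y (a p) + y (b p)}"
        by (auto simp: L_def s_def a_def b_def)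
      show "{y \<in> space M. \<forall>p\<in>L. s r p \<le> y (a p) + y (b p)} \<in> sets M"
      proof (rule sets.sets_Collect_finite_All)
        fix p assume p: "p \<in> L"
        then show "{y \<in> space M. s r p \<le> y (a p) + y (b p)} \<in> sets M"
          unfolding M_def a_def b_def L_def
          by (intro borel_measurable_le borel_measurable_add measurable_component_unif chord
              borel_measurable_const) auto
      qed (simp add: L_def)
    qed
    also have "\<dots> \<le> exp (- (\<Sum>p\<in>L. (s r p)\<^sup>2 / 2))"
      unfolding M_def
    proof (rule measure_PiM_unif_disjoint_pairs)
      show "disjoint_family_on (\<lambda>p. {a p, b p}) L"
        using disjoint_chord_pairs[of r] by (simp add: L_def a_def b_def case_prod_unfold)
      show "0 \<le> s r p" for p unfolding s_def by (intro add_nonneg_nonneg x edge_in_tour)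
      fix p assume p: "p \<in> L"
      have "edge (fst p) (r + 2 * snd p) \<noteq> edge (fst p) (r + 2 * snd p + 1)"
      proof
        assume eq: "edge (fst p) (r + 2 * snd p) = edge (fst p) (r + 2 * snd p + 1)"
        have "1 \<le> fst p" "fst p \<le> m" using p by (auto simp: L_def)
        from edge_eq_iff[OF this this, THEN iffD1, OF eq]
        have "[r + 2 * snd p + 0 = r + 2 * snd p + 1] (mod n)" by simp
        then show False using cong_add_less_imp_eq[of "r + 2 * snd p" 0 1] m n by simp
      qed
      then show "a p \<in> complete_edges V - tour \<and> b p \<in> complete_edges V - tour \<and> a p \<noteq> b p"
        using chord p unfolding a_def b_def L_def by auto
    qed (use fin in \<open>auto simp: L_def\<close>)
    finally show ?thesis by (simp add: q_def)
  qed
  \<comment> \<open>If the claim fails, every offset \<open>r\<close> has an exponent below the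
    target. Summed over \<open>r\<close>, this contradicts the lower bound on the average of
    \<open>q\<close> derived next.\<close>
  have "q r < decay * X" for r
  proof -
    have "exp (- (decay * X)) < exp (- q r)"
      using neg bound[of r] unfolding X_def by linarith
    then show ?thesis by simp
  qed
  then have "(\<Sum>r<n. q r) < (\<Sum>r<n. decay * X)"
    using n_pos by (intro sum_strict_mono) auto
  also have "\<dots> = real (m * (m - 1)) * X"
    using n_pos by (simp add: decay_def)
  also have "\<dots> = (\<Sum>p\<in>L. X)"
    by (simp add: L_def)
  \<comment> \<open>For fixed \<open>p\<close>, each of the two terms runs through a full period as
    \<open>r\<close> varies, so each contributes \<open>X / 2\<close>.\<close>
  also have "\<dots> = (\<Sum>p\<in>L. \<Sum>r<n. (f (r + 2 * snd p) + f (r + 2 * snd p + fst p)) / 2)"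
  proof (rule sum.cong)
    fix p
    have "(\<Sum>r<n. (f (r + 2 * snd p) + f (r + 2 * snd p + fst p)) / 2) =
        ((\<Sum>r<n. f (2 * snd p + r)) + (\<Sum>r<n. f ((2 * snd p + fst p) + r))) / 2"
      by (simp only: sum_divide_distrib[symmetric] sum.distrib) (simp only: ac_simps)
    also have "\<dots> = X" by (simp only: sum_shift_periodic[of f, OF f_periodic] X) simp
    finally show "X = (\<Sum>r<n. (f (r + 2 * snd p) + f (r + 2 * snd p + fst p)) / 2)" ..
  qed simp
  also have "\<dots> \<le> (\<Sum>p\<in>L. \<Sum>r<n. (s r p)\<^sup>2 / 2)"
  proof (intro sum_mono divide_right_mono)
    fix p r
    have "0 \<le> 2 * x (edge 1 (r + 2 * snd p)) * x (edge 1 (r + 2 * snd p + fst p))"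
      by (intro mult_nonneg_nonneg x edge_in_tour) auto
    then show "f (r + 2 * snd p) + f (r + 2 * snd p + fst p) \<le> (s r p)\<^sup>2"
      by (simp add: f_def s_def power2_sum)
  qed simp
  also have "\<dots> = (\<Sum>r<n. q r)" unfolding q_def by (rule sum.swap)
  finally show False by simp
qed

text \<open>A measurable event that contains every weighting for which the tour is 2-optimal; only
  its probability has to be bounded.\<close>

definition chord_event :: "('a set \<Rightarrow> real) set" where
  "chord_event = {w \<in> space (random_weights V). \<forall>d\<in>{2..m}. \<forall>i.
     w (edge 1 i) + w (edge 1 (i + d)) \<le> w (edge d i) + w (edge d (i + 1))}"

lemma sets_chord_event: "chord_event \<in> sets (random_weights V)"
  unfolding chord_event_def
proof (intro sets.sets_Collect_finite_All sets.sets_Collect_countable_All)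
  fix d i assume "d \<in> {2..m}"
  then have *: "edge d i \<in> complete_edges V" for i by (intro edge_complete) auto
  have "edge 1 i \<in> complete_edges V" for i using m by (intro edge_complete) auto
  with * show "{w \<in> space (random_weights V).
      w (edge 1 i) + w (edge 1 (i + d)) \<le> w (edge d i) + w (edge d (i + 1))} \<in> sets (random_weights V)"
    unfolding random_weights_def
    by (intro borel_measurable_le borel_measurable_add measurable_component_unif)
qed simp

lemma two_optimal_chord_event:
  "w \<in> space (random_weights V) \<Longrightarrow> two_optimal V w tour \<Longrightarrow> w \<in> chord_event"
  unfolding chord_event_def using two_optimal_le by auto

text \<open>Conditioning on the tour weights leaves a bound that is a product of Gaussian factors,
  one per tour edge. It integrates coordinate by coordinate.\<close>

lemma measure_chord_event:
  "measure (random_weights V) chord_event \<le> (sqrt (pi / decay) / 2) ^ n"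
proof -
  define J where "J = complete_edges V - tour"
  let ?T = "Pi\<^sub>M tour (\<lambda>_. unif)" and ?J = "Pi\<^sub>M J (\<lambda>_. unif)"
  interpret R: prob_space "random_weights V" by (rule prob_space_random_weights)
  interpret J: prob_space ?J by (intro prob_space_PiM prob_space_unif)
  have union: "complete_edges V = tour \<union> J"
    using is_tour_subset[OF is_tour_tour] by (auto simp: J_def)
  then have weights: "random_weights V = Pi\<^sub>M (tour \<union> J) (\<lambda>_. unif)"
    by (simp add: random_weights_def)
  have fin: "tour \<inter> J = {}" "finite tour" "finite J"
    using finite_V finite_tour by (auto simp: J_def complete_edges_def)
  define A where "A x = {y \<in> space ?J. \<forall>d\<in>{2..m}. \<forall>i.
     x (edge 1 i) + x (edge 1 (i + d)) \<le> y (edge d i) + y (edge d (i + 1))}" for x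
  have chord: "edge d i \<in> J" if "d \<in> {2..m}" for d i
    using that edge_complete[of d] edge_notin_tour[of d] by (auto simp: J_def)
  have A: "A x \<in> sets ?J" for x
    unfolding A_def
    by (intro sets.sets_Collect_finite_All sets.sets_Collect_countable_All borel_measurable_le
        borel_measurable_add borel_measurable_const measurable_component_unif chord) simp_all
  have mono: "emeasure ?J (A x) \<le> (\<Prod>e\<in>tour. ennreal (exp (- (decay * (x e)\<^sup>2))))"
    if "\<forall>e\<in>tour. 0 \<le> x e" for x
  proof -
    have "measure ?J (A x) \<le> exp (- (decay * (\<Sum>e\<in>tour. (x e)\<^sup>2)))"
      using measure_chords_le[of x] that unfolding A_def J_def by auto
    also have "\<dots> = (\<Prod>e\<in>tour. exp (- (decay * (x e)\<^sup>2)))"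
      using fin by (simp add: exp_sum[symmetric] sum_negf sum_distrib_left)
    finally show ?thesis
      by (simp add: J.emeasure_eq_measure prod_ennreal ennreal_leI)
  qed
  \<comment> \<open>The space of \<open>unif\<close> is the whole real line, while the conditional
    bound is for nonnegative tour weights; the exceptions form a null set.\<close>
  have nonneg: "AE x in ?T. \<forall>e\<in>tour. 0 \<le> x e"
  proof (rule AE_finite_allI[OF fin(2)])
    fix e assume "e \<in> tour"
    moreover have "AE u in unif. 0 \<le> u"
      by (rule AE_uniform_measureI) (simp, rule AE_I2, simp)
    ultimately show "AE x in ?T. 0 \<le> x e"
      using AE_PiM_component[of tour "\<lambda>_. unif" e "\<lambda>u. 0 \<le> u"] prob_space_unif by blast
  qed
  have "emeasure (random_weights V) chord_event =
      (\<integral>\<^sup>+w. indicator chord_event w \<partial>random_weights V)"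
    by (rule nn_integral_indicator[symmetric, OF sets_chord_event])
  \<comment> \<open>Fubini: \<open>x\<close> holds the tour weights and \<open>y\<close> the chord
    weights.\<close>
  also have "\<dots> = (\<integral>\<^sup>+x. \<integral>\<^sup>+y. indicator chord_event (merge tour J (x, y)) \<partial>?J \<partial>?T)"
    unfolding weights
    by (rule product_sigma_finite.product_nn_integral_fold[OF product_sigma_finite_unif fin,
          of "indicator chord_event"])
      (rule borel_measurable_indicator[OF sets_chord_event[unfolded weights]])
  also have "\<dots> = (\<integral>\<^sup>+x. emeasure ?J (A x) \<partial>?T)"
  proof (rule nn_integral_cong)
    fix x assume x: "x \<in> space ?T"
    have "(\<integral>\<^sup>+y. indicator chord_event (merge tour J (x, y)) \<partial>?J) = (\<integral>\<^sup>+y. indicator (A x) y \<partial>?J)"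
    proof (rule nn_integral_cong)
      fix y assume y: "y \<in> space ?J"
      have "merge tour J (x, y) \<in> space (random_weights V)"
        unfolding weights using x y by (auto simp: space_pair_measure intro!: measurable_space[OF measurable_merge])
      moreover have "merge tour J (x, y) (edge 1 i) = x (edge 1 i)" for i
        using edge_in_tour by (simp add: merge_def)
      moreover have "merge tour J (x, y) (edge d i) = y (edge d i)" if "d \<in> {2..m}" for d i
        using chord[OF that, of i] fin(1) by (auto simp: merge_def)
      ultimately have "merge tour J (x, y) \<in> chord_event \<longleftrightarrow> y \<in> A x"
        using y by (simp add: chord_event_def A_def)
      then show "(indicator chord_event (merge tour J (x, y)) :: ennreal) = indicator (A x) y"
        by (simp add: indicator_def)
    qed
    then show "(\<integral>\<^sup>+y. indicator chord_event (merge tour J (x, y)) \<partial>?J) = emeasure ?J (A x)"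
      by (simp add: A)
  qed
  also have "\<dots> \<le> (\<integral>\<^sup>+x. (\<Prod>e\<in>tour. ennreal (exp (- (decay * (x e)\<^sup>2)))) \<partial>?T)"
    using nonneg by (intro nn_integral_mono_AE) (auto elim!: eventually_mono intro: mono)
  also have "\<dots> = (\<Prod>e\<in>tour. \<integral>\<^sup>+u. ennreal (exp (- (decay * u\<^sup>2))) \<partial>unif)"
    by (rule product_sigma_finite.product_nn_integral_prod[OF product_sigma_finite_unif fin(2),
          of "\<lambda>_ u. ennreal (exp (- (decay * u\<^sup>2)))"]) measurable
  also have "\<dots> \<le> (\<Prod>e\<in>tour. ennreal (sqrt (pi / decay) / 2))"
    by (intro prod_mono_ennreal nn_integral_unif_gaussian decay_pos)
  also have "\<dots> = ennreal ((sqrt (pi / decay) / 2) ^ n)"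
    unfolding prod_constant card_tour by (rule ennreal_power) (use decay_pos in simp)
  finally show ?thesis
    unfolding R.emeasure_eq_measure
    by (rule ennreal_le_iff[THEN iffD1, rotated]) (use decay_pos in simp)
qed

end

section \<open>Summation over all tours\<close>

lemma card_tours_le:
  assumes "finite V"
  shows "card {T. is_tour V T} \<le> fact (card V)"
proof -
  have "{T. is_tour V T} \<subseteq> cycle_edges ` permutations_of_set V"
    by (auto simp: is_tour_def permutations_of_set_def)
  then have "card {T. is_tour V T} \<le> card (cycle_edges ` permutations_of_set V)"
    by (intro card_mono) auto
  also have "\<dots> \<le> card (permutations_of_set V)" by (rule card_image_le) simp
  finally show ?thesis using assms by simp
qed

lemma expected_two_optimal_le:
  assumes V: "card V = 2 * m + 1" and m: "2 \<le> m"
  shows "expected_two_optimal V \<le> fact (2 * m + 1) *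
    (sqrt (pi * real (2 * m + 1) / real (m * (m - 1))) / 2) ^ (2 * m + 1)"
proof -
  let ?B = "(sqrt (pi * real (2 * m + 1) / real (m * (m - 1))) / 2) ^ (2 * m + 1)"
  let ?R = "random_weights V" and ?A = "{T. is_tour V T}"
  interpret R: prob_space ?R by (rule prob_space_random_weights)
  have fin: "finite V" using V card.infinite by fastforce
  \<comment> \<open>The event depends on the cyclic order picked for \<open>T\<close>, so one event
    per tour is chosen before expectations are summed.\<close>
  have "\<exists>S. S \<in> sets ?R \<and> (\<forall>w\<in>space ?R. two_optimal V w T \<longrightarrow> w \<in> S) \<and> measure ?R S \<le> ?B"
    if "T \<in> ?A" for T
  proof -
    obtain v where v: "cyclic_order V v m (2 * m + 1)" "T = cyclic_order.tour v (2 * m + 1)"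
      using is_tour_cyclic_order[of V T m] \<open>T \<in> ?A\<close> V m by blast
    interpret cyclic_order V v m "2 * m + 1" by (rule v(1))
    have "pi / decay = pi * real (2 * m + 1) / real (m * (m - 1))"
      unfolding decay_def by simp
    then have "measure ?R chord_event \<le> ?B" using measure_chord_event by simp
    then show ?thesis
      using sets_chord_event two_optimal_chord_event v(2) by blast
  qed
  then obtain S where S: "\<And>T. T \<in> ?A \<Longrightarrow> S T \<in> sets ?R"
    "\<And>T w. T \<in> ?A \<Longrightarrow> w \<in> space ?R \<Longrightarrow> two_optimal V w T \<Longrightarrow> w \<in> S T"
    "\<And>T. T \<in> ?A \<Longrightarrow> measure ?R (S T) \<le> ?B"
    by metis
  have finA: "finite ?A" by (rule finite_tours[OF fin])
  have "expected_two_optimal V \<le> (\<integral>w. (\<Sum>T\<in>?A. indicator (S T) w) \<partial>?R)"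
    unfolding expected_two_optimal_def
  proof (rule integral_mono)
    show "integrable ?R (\<lambda>w. real (card {T. two_optimal V w T}))"
      by (rule integrable_count_two_optimal[OF fin])
    show "integrable ?R (\<lambda>w. \<Sum>T\<in>?A. indicator (S T) w :: real)"
      using S(1) by (intro Bochner_Integration.integrable_sum integrable_real_indicator)
        (auto simp: R.emeasure_eq_measure)
    fix w assume w: "w \<in> space ?R"
    have "{T. two_optimal V w T} = {T \<in> ?A. two_optimal V w T}"
      by (auto simp: two_optimal_def)
    then have "real (card {T. two_optimal V w T}) = (\<Sum>T\<in>?A. if two_optimal V w T then 1 else 0)"
      using finA by (simp add: sum.If_cases Int_def)
    also have "\<dots> \<le> (\<Sum>T\<in>?A. indicator (S T) w)"
      using S(2)[OF _ w] by (intro sum_mono) (auto simp: indicator_def)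
    finally show "real (card {T. two_optimal V w T}) \<le> (\<Sum>T\<in>?A. indicator (S T) w)" .
  qed
  also have "\<dots> = (\<Sum>T\<in>?A. measure ?R (S T))"
    using S(1) by (subst Bochner_Integration.integral_sum)
      (auto simp: R.emeasure_eq_measure intro!: sum.cong integrable_real_indicator)
  also have "\<dots> \<le> (\<Sum>T\<in>?A. ?B)" by (intro sum_mono S(3))
  also have "\<dots> = real (card ?A) * ?B" by simp
  also have "\<dots> \<le> fact (2 * m + 1) * ?B"
  proof (rule mult_right_mono)
    show "real (card ?A) \<le> fact (2 * m + 1)"
      using card_tours_le[OF fin] unfolding V by (metis of_nat_fact of_nat_mono)
  qed simp
  finally show ?thesis .
qed

subsection \<open>Asymptotics\<close>

text \<open>A weak form of Stirling's bound with 0.41 in place of \<open>1 / e\<close>. From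
  \<open>k\<close> to \<open>k + 1\<close> the right side grows by the factor
  \<open>0.41 * (k + 1) * (1 + 1 / k) ^ k\<close>, which is eventually at least
  \<open>k + 1\<close>.\<close>

lemma fact_le_power:
  obtains C :: real and N :: nat where "0 < C" "\<And>k. N \<le> k \<Longrightarrow> fact k \<le> C * (0.41 * real k) ^ k"
proof -
  \<comment> \<open>The constant lies below \<open>1 + 1 + 1 / 2\<close> and satisfies
    \<open>0.41 * 2.44 > 1\<close>.\<close>
  have "(2.44 :: real) < exp 1"
    using exp_lower_Taylor_quadratic[of "1 :: real"] by simp
  then have "eventually (\<lambda>k. 2.44 < (1 + 1 / real k) ^ k) sequentially"
    using order_tendstoD(1)[OF tendsto_exp_limit_sequentially[of "1 :: real"]] by blast
  then obtain N where N: "\<And>k. N \<le> k \<Longrightarrow> 2.44 < (1 + 1 / real k) ^ k"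
    by (auto simp: eventually_sequentially)
  define M where "M = max 1 N"
  define C :: real where "C = fact M / (0.41 * real M) ^ M"
  have M: "1 \<le> M" "N \<le> M" by (auto simp: M_def)
  have "fact k \<le> C * (0.41 * real k) ^ k" if "M \<le> k" for k
    using that
  proof (induction k rule: dec_induct)
    case base
    then show ?case using M by (simp add: C_def)
  next
    case (step k)
    have k: "0 < real k" using step M by simp
    have "1 \<le> 0.41 * (1 + 1 / real k) ^ k" using N[of k] step M by simp
    then have "real k ^ k \<le> real k ^ k * (0.41 * (1 + 1 / real k) ^ k)"
      by (intro mult_le_cancel_left1[THEN iffD2]) auto
    also have "\<dots> = 0.41 * real (Suc k) ^ k"
      using k by (simp add: power_mult_distrib[symmetric] field_simps)
    finally have *: "real k ^ k \<le> 0.41 * real (Suc k) ^ k" .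
    have C: "0 \<le> C" by (simp add: C_def)
    have "fact (Suc k) = real (Suc k) * fact k" by simp
    also have "\<dots> \<le> real (Suc k) * (C * (0.41 ^ k * real k ^ k))"
      using step.IH unfolding power_mult_distrib by (rule mult_left_mono) simp
    also have "\<dots> \<le> real (Suc k) * (C * (0.41 ^ k * (0.41 * real (Suc k) ^ k)))"
      using * C by (intro mult_left_mono) auto
    also have "\<dots> = C * (0.41 * real (Suc k)) ^ Suc k"
      unfolding power_Suc power_mult_distrib by (simp only: ac_simps)
    finally show ?case .
  qed
  moreover have "0 < C" using M by (simp add: C_def)
  ultimately show ?thesis using that by blast
qed

text \<open>One factor \<open>sqrt (fact n)\<close> is kept; the other is combined with the bound
  per tour through the estimate of the factorial. The resulting base
  \<open>sqrt (0.41 * n * \<rho>)\<close> tends to \<open>sqrt (0.41 * pi)\<close>, about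
  1.135.\<close>

lemma expected_two_optimal_bound:
  "\<exists>C N. \<forall>m \<ge> N. \<forall>V :: 'a set. card V = 2 * m + 1 \<longrightarrow>
      expected_two_optimal V \<le> C * (1.2098 ^ (2 * m + 1) * sqrt (fact (2 * m + 1)))"
proof -
  obtain C :: real and N where C: "0 < C" and CN: "\<And>k. N \<le> k \<Longrightarrow> fact k \<le> C * (0.41 * real k) ^ k"
    by (rule fact_le_power) (rule that)
  have "expected_two_optimal V \<le> sqrt C * (1.2098 ^ (2 * m + 1) * sqrt (fact (2 * m + 1)))"
    if m: "max 20 N \<le> m" and V: "card V = 2 * m + 1" for m and V :: "'a set"
  proof -
    define n where "n = 2 * m + 1"
    have n: "0 < real n" "N \<le> n" using m by (auto simp: n_def)
    define \<rho> where "\<rho> = pi * real n / real (m * (m - 1)) / 4"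
    have mm: "0 < real (m * (m - 1))" using m by simp
    have \<rho>0: "0 \<le> \<rho>" by (simp add: \<rho>_def)
    have sq: "sqrt (pi * real n / real (m * (m - 1))) / 2 = sqrt \<rho>"
      unfolding \<rho>_def real_sqrt_divide[of _ 4] by simp
    have "0.41 * real n * \<rho> \<le> 1.2098\<^sup>2"
    proof -
      have "20 \<le> real m" using m by simp
      moreover from this have "20 * real m \<le> real m * real m" by (intro mult_right_mono) auto
      moreover have "real (m * (m - 1)) = real m * real m - real m"
        using m by (simp add: of_nat_diff algebra_simps)
      moreover have "(real n)\<^sup>2 = 4 * (real m * real m) + 4 * real m + 1"
        by (simp add: n_def power2_eq_square algebra_simps)
      \<comment> \<open>This amounts to \<open>7.6 * m + 0.9 \<le> 0.4 * m^2\<close>, which holds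
        since \<open>m\<close> is at least 20. The loss \<open>1 / 0.9\<close> is affordable:
        \<open>0.41 * pi / 0.9\<close> is about 1.431, while \<open>1.2098^2\<close> is about
        1.464.\<close>
      ultimately have "0.9 * (real n)\<^sup>2 \<le> 4 * real (m * (m - 1))" by linarith
      then have "(real n)\<^sup>2 / (4 * real (m * (m - 1))) \<le> 1 / 0.9"
        using mm by (simp add: pos_divide_le_eq del: of_nat_mult)
      then have "0.41 * pi * ((real n)\<^sup>2 / (4 * real (m * (m - 1)))) \<le> 0.41 * pi * (1 / 0.9)"
        by (intro mult_left_mono) auto
      also have "0.41 * pi * ((real n)\<^sup>2 / (4 * real (m * (m - 1)))) = 0.41 * real n * \<rho>"
        by (simp add: \<rho>_def power2_eq_square)
      also have "0.41 * pi * (1 / 0.9) \<le> 1.2098\<^sup>2" using pi_approx by (simp add: power2_eq_square)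
      finally show ?thesis .
    qed
    then have "(0.41 * real n * \<rho>) ^ n \<le> (1.2098\<^sup>2) ^ n"
      using \<rho>0 by (intro power_mono) auto
    then have "fact n * \<rho> ^ n \<le> C * (1.2098\<^sup>2) ^ n"
    proof -
      have "fact n * \<rho> ^ n \<le> C * (0.41 * real n) ^ n * \<rho> ^ n"
        using CN[OF n(2)] \<rho>0 by (intro mult_right_mono) auto
      also have "\<dots> = C * (0.41 * real n * \<rho>) ^ n" by (simp only: power_mult_distrib mult.assoc)
      also have "\<dots> \<le> C * (1.2098\<^sup>2) ^ n"
        using C \<open>(0.41 * real n * \<rho>) ^ n \<le> (1.2098\<^sup>2) ^ n\<close> by (intro mult_left_mono) auto
      finally show ?thesis .
    qed
    then have "sqrt (fact n * \<rho> ^ n) \<le> sqrt (C * (1.2098\<^sup>2) ^ n)" by simp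
    then have *: "sqrt (fact n) * sqrt \<rho> ^ n \<le> sqrt C * 1.2098 ^ n"
      by (simp add: real_sqrt_mult real_sqrt_power)
    have "expected_two_optimal V \<le> fact n * sqrt \<rho> ^ n"
      using expected_two_optimal_le[OF V] m unfolding n_def[symmetric] sq by simp
    also have "\<dots> = sqrt (fact n) * (sqrt (fact n) * sqrt \<rho> ^ n)"
      by (simp add: mult.assoc[symmetric])
    also have "\<dots> \<le> sqrt (fact n) * (sqrt C * 1.2098 ^ n)"
      using * by (intro mult_left_mono) auto
    finally show ?thesis unfolding n_def[symmetric] by (simp add: ac_simps)
  qed
  then show ?thesis by (intro exI[of _ "sqrt C"] exI[of _ "max 20 N"]) simp
qed

theorem theorem3:
  "(\<lambda>k::nat. expected_two_optimal {..<2 ^ k + 1 :: nat})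
     \<in> O(\<lambda>k. 1.2098 ^ (2 ^ k + 1) * sqrt (fact (2 ^ k + 1)))"
proof -
  from expected_two_optimal_bound[where 'a = nat]
  obtain C N where CN: "\<forall>m \<ge> N. \<forall>V :: nat set. card V = 2 * m + 1 \<longrightarrow>
      expected_two_optimal V \<le> C * (1.2098 ^ (2 * m + 1) * sqrt (fact (2 * m + 1)))"
    by (elim exE)
  show ?thesis
  \<comment> \<open>Starting at \<open>Suc N\<close> excludes \<open>k = 0\<close>, where
    \<open>2 ^ k + 1\<close> is even, and makes \<open>m = 2 ^ (k - 1)\<close> at least
    \<open>N\<close>.\<close>
  proof (rule bigoI[of _ C], rule eventually_sequentiallyI[of "Suc N"])
    fix k assume k: "Suc N \<le> k"
    define m :: nat where "m = 2 ^ (k - 1)"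
    have "k - 1 < 2 ^ (k - 1)" by (rule less_exp)
    then have m: "N \<le> m" unfolding m_def using k by linarith
    have eq: "2 ^ k = 2 * m" using k by (cases k) (auto simp: m_def)
    have "0 \<le> expected_two_optimal {..<2 ^ k + 1 :: nat}"
      unfolding expected_two_optimal_def by (intro integral_nonneg_AE) auto
    then show "norm (expected_two_optimal {..<2 ^ k + 1 :: nat}) \<le>
        C * norm (1.2098 ^ (2 ^ k + 1) * sqrt (fact (2 ^ k + 1)) :: real)"
      using CN[rule_format, OF m, of "{..<2 ^ k + 1}"] unfolding eq by simp
  qed
qed

end
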